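(* Let $X_1,X_2,\ldots$ and $Y_1,Y_2,\ldots$ be two independent i.i.d. sequences with the same distribution on a finite alphabet $\mathcal{A}$. Let $\gamma$ be the corresponding Chvátal–Sankoff constant. Then $$\gamma\log_2p_o+2(1-\gamma)\log_2q+2h(\gamma)\ge 0 .$$
   Context: For $a\in\mathcal{A}$ let $p_a=P(X_1=a)$, $q=1-\min_{a\in\mathcal{A}}p_a$, $p_o=\sum_{a\in\mathcal{A}}p_a^2$, and $h(x)=-x\log_2x-(1-x)\log_2(1-x)$ (binary entropy, with the convention $0\cdot\log_2 0=0$). $L_n$ is the length of a longest common subsequence of $X_1\ldots X_n$ and $Y_1\ldots Y_n$, i.e. the largest $k$ for which there are $i_1<\cdots<i_k$ and $j_1<\cdots<j_k$ in $\{1,\ldots,n\}$ with $X_{i_t}=Y_{j_t}$ for all $t$. The Chvátal–Sankoff constant $\gamma$ is the constant with $L_n/n\to\gamma$ almost surely and in $L_1$ (it exists by subadditivity). *)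

theory Defs
  imports "HOL-Probability.Probability"
begin

text \<open>Sequences are indexed by the positive integers: \<open>X 0\<close> is never used. That every \<open>X i\<close>
  takes its values in the alphabet \<open>A\<close> is part of the measurability contained in
  \<open>indep_vars\<close>.\<close>

definition iid_on_alphabet :: "'w measure \<Rightarrow> 'a set \<Rightarrow> (nat \<Rightarrow> 'w \<Rightarrow> 'a) \<Rightarrow> bool" where
  "iid_on_alphabet M A X \<longleftrightarrow>
     prob_space.indep_vars M (\<lambda>_. count_space A) X {1..} \<and>
     (\<forall>i\<ge>1. distr M (count_space A) (X i) = distr M (count_space A) (X 1))"

definition indep_sequences ::
  "'w measure \<Rightarrow> 'a set \<Rightarrow> (nat \<Rightarrow> 'w \<Rightarrow> 'a) \<Rightarrow> (nat \<Rightarrow> 'w \<Rightarrow> 'a) \<Rightarrow> bool" where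
  "indep_sequences M A X Y \<longleftrightarrow>
     prob_space.indep_var M
       (PiM {1..} (\<lambda>_. count_space A)) (\<lambda>\<omega>. \<lambda>i\<in>{1..}. X i \<omega>)
       (PiM {1..} (\<lambda>_. count_space A)) (\<lambda>\<omega>. \<lambda>i\<in>{1..}. Y i \<omega>)"

definition is_common_subseq_length :: "(nat \<Rightarrow> 'a) \<Rightarrow> (nat \<Rightarrow> 'a) \<Rightarrow> nat \<Rightarrow> nat \<Rightarrow> bool" where
  "is_common_subseq_length x y n k \<longleftrightarrow>
     (\<exists>i j. i \<in> {1..k} \<rightarrow> {1..n} \<and> strict_mono_on {1..k} i \<and>
            j \<in> {1..k} \<rightarrow> {1..n} \<and> strict_mono_on {1..k} j \<and>
            (\<forall>t\<in>{1..k}. x (i t) = y (j t)))"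

text \<open>The set below contains \<open>0\<close> and is bounded by \<open>n\<close>, so the maximum is meaningful.\<close>

definition lcs_length :: "(nat \<Rightarrow> 'a) \<Rightarrow> (nat \<Rightarrow> 'a) \<Rightarrow> nat \<Rightarrow> nat" where
  "lcs_length x y n = Max {k. is_common_subseq_length x y n k}"

definition L :: "(nat \<Rightarrow> 'w \<Rightarrow> 'a) \<Rightarrow> (nat \<Rightarrow> 'w \<Rightarrow> 'a) \<Rightarrow> nat \<Rightarrow> 'w \<Rightarrow> real" where
  "L X Y n \<omega> = real (lcs_length (\<lambda>i. X i \<omega>) (\<lambda>i. Y i \<omega>) n)"

text \<open>Convergence in $L_1$ is stated with the nonnegative integral, so that it has its intended
  meaning without a separate integrability condition.\<close>

definition is_chvatal_sankoff_constant ::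
  "'w measure \<Rightarrow> (nat \<Rightarrow> 'w \<Rightarrow> 'a) \<Rightarrow> (nat \<Rightarrow> 'w \<Rightarrow> 'a) \<Rightarrow> real \<Rightarrow> bool" where
  "is_chvatal_sankoff_constant M X Y \<gamma> \<longleftrightarrow>
     (AE \<omega> in M. (\<lambda>n. L X Y n \<omega> / real n) \<longlonglongrightarrow> \<gamma>) \<and>
     (\<lambda>n. \<integral>\<^sup>+\<omega>. ennreal \<bar>L X Y n \<omega> / real n - \<gamma>\<bar> \<partial>M) \<longlonglongrightarrow> 0"

definition letter_prob :: "'w measure \<Rightarrow> (nat \<Rightarrow> 'w \<Rightarrow> 'a) \<Rightarrow> 'a \<Rightarrow> real" where
  "letter_prob M X a = measure M {\<omega> \<in> space M. X 1 \<omega> = a}"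

definition q_param :: "'w measure \<Rightarrow> 'a set \<Rightarrow> (nat \<Rightarrow> 'w \<Rightarrow> 'a) \<Rightarrow> real" where
  "q_param M A X = 1 - Min (letter_prob M X ` A)"

definition p_o :: "'w measure \<Rightarrow> 'a set \<Rightarrow> (nat \<Rightarrow> 'w \<Rightarrow> 'a) \<Rightarrow> real" where
  "p_o M A X = (\<Sum>a\<in>A. (letter_prob M X a)\<^sup>2)"

text \<open>The convention $0 \cdot \log_2 0 = 0$ holds automatically, here and for the term containing
  \<open>q_param\<close> in the theorem. \<open>q_param\<close> vanishes only for a one-letter alphabet, where the
  Chvatal-Sankoff constant is 1.\<close>

definition binary_entropy :: "real \<Rightarrow> real" where
  "binary_entropy x = - x * log 2 x - (1 - x) * log 2 (1 - x)"

end

theory Submission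
  imports Defs "HOL-Library.Sublist" "HOL-Real_Asymp.Real_Asymp"
begin

text \<open>Let \<open>S(w, n)\<close> be the probability that a word \<open>w\<close> of length \<open>k\<close> is a subsequence of \<open>n\<close> random
  letters, and \<open>p(w)\<close> the product of the probabilities of its letters. Splitting off the first random
  letter gives \<open>S(a w, n + 1) = p(a) S(w, n) + (1 - p(a)) S(a w, n)\<close>, so by induction
  \<open>S(w, n) \<le> p(w) z^n / (z - q)^k\<close> for every \<open>z \<ge> 1\<close> with \<open>z > q\<close>. A union bound over all \<open>w\<close> yields
  \<open>P(L n \<ge> k) \<le> z^(2 n) (p_o / (z - q)^2)^k\<close>. For \<open>k\<close> slightly below \<open>\<gamma> n\<close> this probability stays
  away from \<open>0\<close>, whence \<open>2 log z + \<gamma> log (p_o / (z - q)^2) \<ge> 0\<close>. The optimal choice is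
  \<open>z = q / (1 - \<gamma>)\<close> (and \<open>z \<rightarrow> \<infinity>\<close> if \<open>\<gamma> = 1\<close>); it satisfies \<open>z \<ge> 1\<close> because matching equal letters
  at equal positions shows \<open>\<gamma> \<ge> p_o \<ge> 1 - q\<close>.\<close>

section \<open>Words over the alphabet and the subsequence probability of a fixed word\<close>

definition words :: "'a set \<Rightarrow> nat \<Rightarrow> 'a list set" where
  "words A n = {xs. set xs \<subseteq> A \<and> length xs = n}"

definition weight :: "('a \<Rightarrow> real) \<Rightarrow> 'a list \<Rightarrow> real" where
  "weight p w = prod_list (map p w)"

text \<open>This is the \<open>S(w, n)\<close> of the outline, kept as a finite sum so that its
  recursion and bounds need no measure space.\<close>

definition subseq_weight :: "('a \<Rightarrow> real) \<Rightarrow> 'a set \<Rightarrow> nat \<Rightarrow> 'a list \<Rightarrow> real" where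
  "subseq_weight p A n w = (\<Sum>x\<in>words A n. weight p x * of_bool (subseq w x))"

text \<open>Sequences start at index 1 and lists at 0, so the letter \<open>x i\<close> sits at
  position \<open>i - 1\<close>.\<close>

definition prefix_word :: "(nat \<Rightarrow> 'a) \<Rightarrow> nat \<Rightarrow> 'a list" where
  "prefix_word x n = map x [1..<Suc n]"

lemma finite_words: "finite A \<Longrightarrow> finite (words A n)"
  unfolding words_def by (rule finite_lists_length_eq)

lemma words_0: "words A 0 = {[]}"
  by (auto simp: words_def)

lemma sum_words_Suc: "(\<Sum>x\<in>words A (Suc n). f x) = (\<Sum>a\<in>A. \<Sum>x\<in>words A n. f (a # x))"
proof -
  have "words A (Suc n) = (\<lambda>(a, x). a # x) ` (A \<times> words A n)"
    by (auto simp: words_def length_Suc_conv)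
  moreover have "inj_on (\<lambda>(a, x). a # x) (A \<times> words A n)"
    by (auto simp: inj_on_def)
  ultimately show ?thesis
    by (simp add: sum.reindex sum.cartesian_product comp_def case_prod_unfold)
qed

text \<open>Serves twice: with \<open>p\<close> it gives total mass 1, with the squared letter
  probabilities it gives the k-th power of \<open>p_o\<close>.\<close>

lemma sum_weight_words: "(\<Sum>w\<in>words A n. weight p w) = (\<Sum>a\<in>A. p a) ^ n"
  by (induction n) (simp_all add: words_0 sum_words_Suc weight_def
      sum_distrib_left[symmetric] sum_distrib_right[symmetric])

lemma weight_power2: "(weight p w)\<^sup>2 = weight (\<lambda>a. (p a)\<^sup>2) w"
  by (induction w) (simp_all add: weight_def power_mult_distrib)

lemma weight_nonneg: "(\<And>a. p a \<ge> 0) \<Longrightarrow> weight p w \<ge> 0"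
  by (induction w) (simp_all add: weight_def)

lemma subseq_weight_nonneg: "(\<And>a. p a \<ge> 0) \<Longrightarrow> subseq_weight p A n w \<ge> 0"
  unfolding subseq_weight_def by (intro sum_nonneg mult_nonneg_nonneg weight_nonneg) auto

text \<open>Greedy matching loses nothing: a first random letter equal to \<open>a\<close> may be
  matched at once, leaving \<open>w\<close>; any other first letter is useless.\<close>

lemma subseq_weight_Cons_Suc:
  assumes "finite A" "a \<in> A" "(\<Sum>b\<in>A. p b) = 1"
  shows "subseq_weight p A (Suc n) (a # w) =
    p a * subseq_weight p A n w + (1 - p a) * subseq_weight p A n (a # w)"
proof -
  have "subseq_weight p A (Suc n) (a # w) =
      (\<Sum>b\<in>A. p b * (\<Sum>x\<in>words A n. weight p x * of_bool (subseq (a # w) (b # x))))"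
    by (simp add: subseq_weight_def sum_words_Suc weight_def sum_distrib_left mult.assoc
        del: subseq_Cons2_iff)
  also have "\<dots> = (\<Sum>b\<in>A. p b * (if b = a then subseq_weight p A n w
      else subseq_weight p A n (a # w)))"
    by (intro sum.cong) (auto simp: subseq_weight_def)
  also have "\<dots> = p a * subseq_weight p A n w
      + (\<Sum>b\<in>A - {a}. p b * subseq_weight p A n (a # w))"
    using assms by (subst sum.remove[of A a]) auto
  also have "(\<Sum>b\<in>A - {a}. p b * subseq_weight p A n (a # w))
      = (1 - p a) * subseq_weight p A n (a # w)"
    using assms by (simp add: sum_distrib_right[symmetric] sum_diff1)
  finally show ?thesis .
qed

text \<open>A Chernoff bound in disguise. The time T at which greedy matching completes
  \<open>w\<close> is a sum of independent geometric times, so E z^(-T) is the product of p(a) / (z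
  - (1 - p(a))), where each denominator is at least z - q; and P(T \<le> n) \<le> z^n E z^(-T). The
  induction avoids T altogether.\<close>

lemma subseq_weight_le:
  assumes A: "finite A" "(\<Sum>a\<in>A. p a) = 1"
    and p: "\<And>a. p a \<ge> 0" "\<And>a. a \<in> A \<Longrightarrow> 1 - p a \<le> q"
    and z: "z \<ge> 1" "z > q"
    and w: "set w \<subseteq> A"
  shows "subseq_weight p A n w \<le> weight p w * z ^ n / (z - q) ^ length w"
  using w
proof (induction n arbitrary: w)
  case 0
  then show ?case
    using z weight_nonneg[of p w] p(1)
    by (cases w) (simp_all add: subseq_weight_def words_0 weight_def)
next
  case (Suc n)
  show ?case
  proof (cases w)
    case Nil
    have "subseq_weight p A (Suc n) [] = 1"
      using sum_weight_words[of p A "Suc n"] A by (simp add: subseq_weight_def)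
    \<comment> \<open>The empty word is always found, and \<open>z \<ge> 1\<close> makes the bound
      at least 1.\<close>
    then show ?thesis
      using Nil z one_le_power[of z "Suc n"] by (simp add: weight_def)
  next
    case (Cons a u)
    let ?c = "weight p w * z ^ n / (z - q) ^ length w"
    have a: "a \<in> A" "set u \<subseteq> A" using Suc.prems Cons by auto
    have "p a \<le> 1" using A p(1) member_le_sum[of a A p] a by auto
    then have "0 \<le> q" using p(2)[OF a(1)] by linarith
    have "subseq_weight p A (Suc n) w =
        p a * subseq_weight p A n u + (1 - p a) * subseq_weight p A n w"
      unfolding Cons using A a by (intro subseq_weight_Cons_Suc) auto
    also have "\<dots> \<le> p a * (weight p u * z ^ n / (z - q) ^ length u) + q * ?c"
      using \<open>0 \<le> q\<close>
      by (intro add_mono mult_mono Suc.IH p Suc.prems a subseq_weight_nonneg order.refl)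
    \<comment> \<open>Dropping the letter \<open>a\<close> from the word costs exactly a factor z -
      q; together with the coefficient q of the other term this sums to z, the factor for one more
      random letter.\<close>
    also have "p a * (weight p u * z ^ n / (z - q) ^ length u) = (z - q) * ?c"
      using z by (simp add: Cons weight_def)
    also have "(z - q) * ?c + q * ?c = z * ?c"
      by (simp only: distrib_right[symmetric] diff_add_cancel)
    finally show ?thesis by (simp add: ac_simps)
  qed
qed

text \<open>The square is the probability that two independent random words both contain
  \<open>w\<close>. Squaring turns the weights into products of squared letter probabilities, whose
  sum factorizes.\<close>

lemma sum_subseq_weight_power2_le:
  assumes A: "finite A" "(\<Sum>a\<in>A. p a) = 1"
    and p: "\<And>a. p a \<ge> 0" "\<And>a. a \<in> A \<Longrightarrow> 1 - p a \<le> q"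
    and z: "z \<ge> 1" "z > q"
  shows "(\<Sum>w\<in>words A k. (subseq_weight p A n w)\<^sup>2)
    \<le> (z\<^sup>2) ^ n * ((\<Sum>a\<in>A. (p a)\<^sup>2) / (z - q)\<^sup>2) ^ k"
proof -
  have "(\<Sum>w\<in>words A k. (subseq_weight p A n w)\<^sup>2)
      \<le> (\<Sum>w\<in>words A k. (weight p w * z ^ n / (z - q) ^ k)\<^sup>2)"
  proof (intro sum_mono power_mono)
    fix w assume "w \<in> words A k"
    then show "subseq_weight p A n w \<le> weight p w * z ^ n / (z - q) ^ k"
      using subseq_weight_le[of A p q z w n] assms by (auto simp: words_def)
  qed (use p(1) in \<open>rule subseq_weight_nonneg\<close>)
  also have "\<dots> = (\<Sum>w\<in>words A k. weight (\<lambda>a. (p a)\<^sup>2) w) * ((z ^ n)\<^sup>2 / ((z - q) ^ k)\<^sup>2)"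
    by (simp add: sum_distrib_right sum_divide_distrib power_mult_distrib power_divide weight_power2)
  also have "\<dots> = (\<Sum>a\<in>A. (p a)\<^sup>2) ^ k * ((z ^ n)\<^sup>2 / ((z - q) ^ k)\<^sup>2)"
    by (simp add: sum_weight_words)
  also have "\<dots> = (z\<^sup>2) ^ n * ((\<Sum>a\<in>A. (p a)\<^sup>2) / (z - q)\<^sup>2) ^ k"
    by (simp add: power_divide power_mult[symmetric] mult.commute)
  finally show ?thesis .
qed

section \<open>Common subsequences: from index functions to words\<close>

lemma is_common_subseq_length_cong:
  assumes "\<And>i. i \<in> {1..n} \<Longrightarrow> x i = x' i" "\<And>i. i \<in> {1..n} \<Longrightarrow> y i = y' i"
  shows "is_common_subseq_length x y n k \<longleftrightarrow> is_common_subseq_length x' y' n k"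
proof -
  have eq: "x (i t) = x' (i t)" "y (i t) = y' (i t)"
    if "i \<in> {1..k} \<rightarrow> {1..n}" "t \<in> {1..k}" for i t
    using assms(1,2)[of "i t"] that by blast+
  show ?thesis
    unfolding is_common_subseq_length_def
    by (intro ex_cong1 conj_cong refl ball_cong) (simp_all add: eq)
qed

text \<open>Exhibits the LCS length as a function of the two prefixes alone, which later yields
  measurability of \<open>L\<close>.\<close>

lemma lcs_length_prefix_word:
  "lcs_length x y n =
    lcs_length (\<lambda>i. prefix_word x n ! (i - 1)) (\<lambda>i. prefix_word y n ! (i - 1)) n"
  unfolding lcs_length_def
  by (intro arg_cong[where f = Max] Collect_cong is_common_subseq_length_cong)
    (auto simp: prefix_word_def simp del: upt_Suc)

text \<open>The increasing list of positions is itself a sublist of \<open>[1..<Suc n]\<close>, and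
  applying \<open>x\<close> entrywise preserves this.\<close>

lemma subseq_prefix_word:
  assumes "i \<in> {1..k} \<rightarrow> {1..n}" "strict_mono_on {1..k} i"
  shows "subseq (map (\<lambda>t. x (i t)) [1..<Suc k]) (prefix_word x n)"
proof -
  have "sorted_wrt (\<lambda>s t. i s < i t) [1..<Suc k]"
    by (rule sorted_wrt_mono_rel[OF _ sorted_wrt_upt])
      (use assms(2) in \<open>auto simp: strict_mono_on_def\<close>)
  then have "sorted_wrt (<) (map i [1..<Suc k])"
    by (simp add: sorted_wrt_map)
  moreover have "set (map i [1..<Suc k]) \<subseteq> set [1..<Suc n]"
    using assms(1) by (auto simp: Pi_iff less_Suc_eq_le simp del: upt_Suc)
  ultimately have "subseq (map i [1..<Suc k]) [1..<Suc n]"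
    by (intro sorted_subset_imp_subseq) (simp_all del: upt_Suc)
  from subseq_map[OF this, of x] show ?thesis
    by (simp add: prefix_word_def comp_def)
qed

lemma common_subseq_word:
  assumes "is_common_subseq_length x y n k"
  shows "\<exists>w. length w = k \<and> subseq w (prefix_word x n) \<and> subseq w (prefix_word y n)"
proof -
  obtain i j where ij: "i \<in> {1..k} \<rightarrow> {1..n}" "strict_mono_on {1..k} i"
      "j \<in> {1..k} \<rightarrow> {1..n}" "strict_mono_on {1..k} j" "\<forall>t\<in>{1..k}. x (i t) = y (j t)"
    using assms unfolding is_common_subseq_length_def by blast
  have "map (\<lambda>t. x (i t)) [1..<Suc k] = map (\<lambda>t. y (j t)) [1..<Suc k]"
    using ij(5) by (simp del: upt_Suc)
  then show ?thesis
    using subseq_prefix_word[OF ij(1,2), of x] subseq_prefix_word[OF ij(3,4), of y]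
    by (intro exI[of _ "map (\<lambda>t. x (i t)) [1..<Suc k]"]) (metis length_map length_upt diff_Suc_1)
qed

lemma is_common_subseq_length_le:
  assumes "is_common_subseq_length x y n k"
  shows "k \<le> n"
proof -
  obtain w where "length w = k" "subseq w (prefix_word x n)"
    using common_subseq_word[OF assms] by blast
  then show ?thesis
    using list_emb_length[of "(=)" w "prefix_word x n"]
    by (simp add: prefix_word_def del: upt_Suc)
qed

lemma finite_common_subseq_lengths: "finite {k. is_common_subseq_length x y n k}"
  by (rule finite_subset[of _ "{..n}"]) (auto dest: is_common_subseq_length_le)

lemma is_common_subseq_length_lcs: "is_common_subseq_length x y n (lcs_length x y n)"
proof -
  have "is_common_subseq_length x y n 0"
    by (auto simp: is_common_subseq_length_def)
  then show ?thesis
    using Max_in[OF finite_common_subseq_lengths[of x y n]] unfolding lcs_length_def by blast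
qed

lemma lcs_length_le: "lcs_length x y n \<le> n"
  using is_common_subseq_length_lcs by (rule is_common_subseq_length_le)

lemma lcs_length_ge:
  "is_common_subseq_length x y n k \<Longrightarrow> k \<le> lcs_length x y n"
  unfolding lcs_length_def by (rule Max_ge[OF finite_common_subseq_lengths]) simp

text \<open>Truncating a longest common subsequence gives a witness of length exactly
  \<open>k\<close>, so a union bound need only range over words of that length.\<close>

lemma lcs_length_ge_word:
  assumes "k \<le> lcs_length x y n"
  shows "\<exists>w. length w = k \<and> subseq w (prefix_word x n) \<and> subseq w (prefix_word y n)"
proof -
  obtain w where w: "length w = lcs_length x y n" "subseq w (prefix_word x n)"
      "subseq w (prefix_word y n)"
    using common_subseq_word[OF is_common_subseq_length_lcs] by blast
  have "subseq (take k w) w"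
    by (metis append_take_drop_id list_emb_append2 subseq_order.order_refl subseq_rev_drop_many)
  then show ?thesis
    using w assms by (intro exI[of _ "take k w"]) (auto intro: subseq_order.trans)
qed

lemma lcs_length_ge_matches: "card {i\<in>{1..n}. x i = y i} \<le> lcs_length x y n"
proof (rule lcs_length_ge)
  let ?S = "{i\<in>{1..n}. x i = y i}"
  \<comment> \<open>The increasing enumeration of the matching positions serves as index function
    for both sequences.\<close>
  define l where "l = sorted_list_of_set ?S"
  have l: "length l = card ?S" "set l = ?S" "sorted_wrt (<) l"
    by (simp_all add: l_def)
  have mem: "l ! (t - 1) \<in> ?S" if "t \<in> {1..card ?S}" for t
    using that l nth_mem[of "t - 1" l] by (metis (no_types, lifting) One_nat_def Suc_le_eq Suc_pred' atLeastAtMost_iff)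
  have mono: "strict_mono_on {1..card ?S} (\<lambda>t. l ! (t - 1))"
    using l by (auto simp: strict_mono_on_def intro!: sorted_wrt_nth_less[OF l(3)])
  show "is_common_subseq_length x y n (card ?S)"
    unfolding is_common_subseq_length_def
    using mem mono by (intro exI[of _ "\<lambda>t. l ! (t - 1)"]) fastforce
qed

section \<open>Real analysis: from exponential bounds to the entropy inequality\<close>

lemma growth_exponent_nonneg:
  fixes a b g :: real
  assumes g: "0 < g"
    and bound: "\<And>d. 0 < d \<Longrightarrow> d < g \<Longrightarrow>
      (\<exists>e>0. \<forall>\<^sub>F n in sequentially. e \<le> exp (real n * a + real (nat \<lceil>(g - d) * real n\<rceil>) * b))"
  shows "0 \<le> a + g * b"
proof (rule ccontr)
  assume "\<not> 0 \<le> a + g * b"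
  then have neg: "a + g * b < 0" by simp
  \<comment> \<open>A negative exponent stays negative for a small \<open>d > 0\<close> by
    continuity; the exponential then decays to 0, against the positive lower bound
    \<open>e\<close>.\<close>
  have "\<forall>\<^sub>F d in at_right 0. a + (g - d) * b < 0"
    by (rule order_tendstoD(2)[OF _ neg]) (auto intro!: tendsto_eq_intros)
  moreover have "\<forall>\<^sub>F d in at_right 0. d \<in> {0<..<g}"
    using g by (intro eventually_at_right_real) auto
  ultimately have "\<forall>\<^sub>F d in at_right (0::real). a + (g - d) * b < 0 \<and> d \<in> {0<..<g}"
    by eventually_elim simp
  then obtain d where d: "a + (g - d) * b < 0" "0 < d" "d < g"
    using eventually_happens'[of "at_right (0::real)"] by fastforce
  obtain e where e: "e > 0" "\<forall>\<^sub>F n in sequentially.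
      e \<le> exp (real n * a + real (nat \<lceil>(g - d) * real n\<rceil>) * b)"
    using bound d by blast
  \<comment> \<open>The summand \<open>\<bar>b\<bar>\<close> absorbs the rounding in the ceiling,
    whatever the sign of \<open>b\<close>.\<close>
  have "(\<lambda>n. exp (real n * (a + (g - d) * b) + \<bar>b\<bar>)) \<longlonglongrightarrow> 0"
    using d(1) by real_asymp
  then have "\<forall>\<^sub>F n in sequentially. exp (real n * (a + (g - d) * b) + \<bar>b\<bar>) < e"
    using e(1) by (rule order_tendstoD)
  with e(2) have "\<forall>\<^sub>F n::nat in sequentially. False"
  proof eventually_elim
    case (elim n)
    define r where "r = real (nat \<lceil>(g - d) * real n\<rceil>) - (g - d) * real n"
    \<comment> \<open>Nonnegativity keeps \<open>nat\<close> from truncating, so the rounding error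
      \<open>r\<close> lies between 0 and 1.\<close>
    have "0 \<le> (g - d) * real n" using d by simp
    then have "0 \<le> r" "r \<le> 1" unfolding r_def by linarith+
    then have "r * b \<le> 1 * \<bar>b\<bar>" by (intro order_trans[OF _ mult_right_mono[of r 1]]) (auto intro: mult_left_mono)
    then have "real n * a + real (nat \<lceil>(g - d) * real n\<rceil>) * b
        \<le> real n * (a + (g - d) * b) + \<bar>b\<bar>"
      by (simp add: r_def algebra_simps)
    with elim show ?case by (smt (verit) exp_le_cancel_iff)
  qed
  then show False by simp
qed

lemma entropy_bound_of_exponents:
  fixes \<gamma> q r :: real
  assumes \<gamma>: "0 < \<gamma>" "\<gamma> \<le> 1" and q: "0 \<le> q" "1 - q \<le> \<gamma>" and r: "0 < r"
    and bound: "\<And>z. z \<ge> 1 \<Longrightarrow> z > q \<Longrightarrow> 0 \<le> ln (z\<^sup>2) + \<gamma> * ln (r / (z - q)\<^sup>2)"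
  shows "0 \<le> \<gamma> * log 2 r + 2 * (1 - \<gamma>) * log 2 q + 2 * binary_entropy \<gamma>"
proof (cases "\<gamma> = 1")
  case True
  \<comment> \<open>Here no finite z is optimal; the best bound is the limit as z tends to
    infinity.\<close>
  have "((\<lambda>z::real. ln (z\<^sup>2) + ln (r / (z - q)\<^sup>2)) \<longlongrightarrow> ln r) at_top"
    using r by real_asymp
  moreover have "\<forall>\<^sub>F z in at_top. 0 \<le> ln (z\<^sup>2) + ln (r / (z - q)\<^sup>2)"
    using eventually_ge_at_top[of 1] eventually_gt_at_top[of q]
    by eventually_elim (use bound True in auto)
  ultimately have "0 \<le> ln r"
    by (rule tendsto_lowerbound) simp
  \<comment> \<open>The factor 1 - \<gamma> = 0 removes the logarithms of \<open>q\<close> and of 1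
    - \<gamma>, whatever value \<open>log\<close> takes at 0.\<close>
  with True show ?thesis
    by (simp add: binary_entropy_def log_def)
next
  case False
  then have g1: "\<gamma> < 1" and qpos: "0 < q" using \<gamma> q by auto
  \<comment> \<open>The stationary point of 2 ln z - 2 \<gamma> ln (z - q), determined by z - q =
    \<gamma> z. The requirement z \<ge> 1 is precisely 1 - q \<le> \<gamma>.\<close>
  define z where "z = q / (1 - \<gamma>)"
  have zq: "z - q = q * \<gamma> / (1 - \<gamma>)"
    using g1 by (simp add: z_def field_simps)
  have "z \<ge> 1" using g1 q by (simp add: z_def)
  moreover have "z - q > 0" unfolding zq using g1 qpos \<gamma> by simp
  ultimately have "0 \<le> ln (z\<^sup>2) + \<gamma> * ln (r / (z - q)\<^sup>2)" by (intro bound) auto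
  also have "ln (z\<^sup>2) = 2 * (ln q - ln (1 - \<gamma>))"
    using qpos g1 by (simp add: z_def ln_realpow ln_div)
  also have "ln (r / (z - q)\<^sup>2) = ln r - 2 * (ln q + ln \<gamma> - ln (1 - \<gamma>))"
    unfolding zq using qpos g1 \<gamma> r by (simp add: ln_realpow ln_div ln_mult)
  finally have "0 \<le> (\<gamma> * ln r + 2 * (1 - \<gamma>) * ln q
      + 2 * (- \<gamma> * ln \<gamma> - (1 - \<gamma>) * ln (1 - \<gamma>))) / ln 2"
    by (intro divide_nonneg_pos) (auto simp: algebra_simps)
  also have "\<dots> = \<gamma> * log 2 r + 2 * (1 - \<gamma>) * log 2 q + 2 * binary_entropy \<gamma>"
    by (simp add: binary_entropy_def log_def field_simps)
  finally show ?thesis .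
qed

section \<open>The law of a random prefix\<close>

lemma prefix_word_eq_iff:
  assumes "length w = n"
  shows "prefix_word x n = w \<longleftrightarrow> (\<forall>i\<in>{1..n}. x i = w ! (i - 1))"
proof -
  have "prefix_word x n = w \<longleftrightarrow> (\<forall>i<n. x (Suc i) = w ! i)"
    using assms by (auto simp: prefix_word_def list_eq_iff_nth_eq simp del: upt_Suc)
  also have "\<dots> \<longleftrightarrow> (\<forall>i\<in>{1..n}. x i = w ! (i - 1))"
    by (metis One_nat_def Suc_le_eq Suc_pred' atLeastAtMost_iff diff_Suc_1 le_add1 plus_1_eq_Suc)
  finally show ?thesis .
qed

lemma weight_conv_prod: "weight p w = (\<Prod>i\<in>{1..length w}. p (w ! (i - 1)))"
  by (simp add: weight_def prod.list_conv_set_nth prod.atLeast1_atMost_eq atLeast0LessThan)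

text \<open>Lets independence of the whole sequences pass to their prefixes. As the target is
  finite, singletons suffice, and their preimages are cut out by finitely many coordinate
  conditions.\<close>

lemma prefix_word_measurable:
  assumes "finite A"
  shows "(\<lambda>f. prefix_word f n) \<in> PiM {1..} (\<lambda>_. count_space A) \<rightarrow>\<^sub>M count_space (words A n)"
    (is "_ \<in> ?P \<rightarrow>\<^sub>M _")
  unfolding measurable_count_space_eq2[OF finite_words[OF assms]]
proof (intro conjI ballI)
  show "(\<lambda>f. prefix_word f n) \<in> space ?P \<rightarrow> words A n"
    by (auto simp: prefix_word_def words_def space_PiM PiE_iff simp del: upt_Suc)
  fix w assume w: "w \<in> words A n"
  have "{f \<in> space ?P. f i = w ! (i - 1)} \<in> sets ?P" if "i \<in> {1..n}" for i
  proof -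
    have "w ! (i - 1) \<in> A" using that w nth_mem[of "i - 1" w] by (auto simp: words_def)
    then have "(\<lambda>f. f i) -` {w ! (i - 1)} \<inter> space ?P \<in> sets ?P"
      using that by (intro measurable_sets[OF measurable_component_singleton]) auto
    then show ?thesis by (simp add: vimage_def Int_def conj_commute)
  qed
  then have "{f \<in> space ?P. \<forall>i\<in>{1..n}. f i = w ! (i - 1)} \<in> sets ?P"
    by (intro sets.sets_Collect_finite_All) auto
  also have "{f \<in> space ?P. \<forall>i\<in>{1..n}. f i = w ! (i - 1)} = (\<lambda>f. prefix_word f n) -` {w} \<inter> space ?P"
    using w by (auto simp: words_def prefix_word_eq_iff)
  finally show "(\<lambda>f. prefix_word f n) -` {w} \<inter> space ?P \<in> sets ?P" .
qed

lemma (in prob_space) prob_prefix_word: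
  assumes ind: "indep_vars (\<lambda>_. count_space A) X {1..}"
    and p: "\<And>i a. i \<ge> 1 \<Longrightarrow> a \<in> A \<Longrightarrow> prob {\<omega> \<in> space M. X i \<omega> = a} = p a"
    and w: "w \<in> words A n"
  shows "prob {\<omega> \<in> space M. prefix_word (\<lambda>i. X i \<omega>) n = w} = weight p w"
\<comment> \<open>Length 0 is treated apart: the product rule for independent variables takes a
  nonempty index set, and an empty intersection would be \<open>UNIV\<close> instead of
  \<open>space M\<close>.\<close>
proof (cases "n = 0")
  case True
  with w show ?thesis by (simp add: prefix_word_def words_def weight_def prob_space)
next
  case False
  have n: "length w = n" using w by (simp add: words_def)
  have mem: "w ! (i - 1) \<in> A" if "i \<in> {1..n}" for i
    using that w nth_mem[of "i - 1" w] by (auto simp: words_def)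
  have "{\<omega> \<in> space M. prefix_word (\<lambda>i. X i \<omega>) n = w} =
      (\<Inter>i\<in>{1..n}. X i -` {w ! (i - 1)} \<inter> space M)"
    using False by (auto simp: prefix_word_eq_iff[OF n])
  also have "prob \<dots> = (\<Prod>i\<in>{1..n}. prob (X i -` {w ! (i - 1)} \<inter> space M))"
    using False mem by (intro indep_varsD[OF ind]) auto
  also have "\<dots> = (\<Prod>i\<in>{1..n}. p (w ! (i - 1)))"
  proof (intro prod.cong refl)
    fix i assume "i \<in> {1..n}"
    then show "prob (X i -` {w ! (i - 1)} \<inter> space M) = p (w ! (i - 1))"
      using p[of i "w ! (i - 1)"] mem[of i] by (simp add: vimage_def Int_def conj_commute)
  qed
  finally show ?thesis by (simp add: weight_conv_prod n)
qed

text \<open>Links the finite sum to the probability space by splitting the event according to the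
  value of the prefix.\<close>

lemma (in prob_space) prob_subseq_prefix_word:
  assumes A: "finite A"
    and meas: "(\<lambda>\<omega>. prefix_word (\<lambda>i. X i \<omega>) n) \<in> M \<rightarrow>\<^sub>M count_space (words A n)"
    and ind: "indep_vars (\<lambda>_. count_space A) X {1..}"
    and p: "\<And>i a. i \<ge> 1 \<Longrightarrow> a \<in> A \<Longrightarrow> prob {\<omega> \<in> space M. X i \<omega> = a} = p a"
  shows "prob {\<omega> \<in> space M. subseq w (prefix_word (\<lambda>i. X i \<omega>) n)} = subseq_weight p A n w"
proof -
  let ?W = "\<lambda>\<omega>. prefix_word (\<lambda>i. X i \<omega>) n" and ?I = "{x \<in> words A n. subseq w x}"
  have "{\<omega> \<in> space M. subseq w (?W \<omega>)} = (\<Union>x\<in>?I. {\<omega> \<in> space M. ?W \<omega> = x})"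
    using measurable_space[OF meas] by auto
  also have "prob \<dots> = (\<Sum>x\<in>?I. prob {\<omega> \<in> space M. ?W \<omega> = x})"
  proof (rule finite_measure_finite_Union)
    show "(\<lambda>x. {\<omega> \<in> space M. ?W \<omega> = x}) ` ?I \<subseteq> events"
      using measurable_sets[OF meas, of "{_}"]
      by (auto simp: vimage_def Int_def conj_commute)
  qed (auto simp: finite_words A disjoint_family_on_def)
  also have "\<dots> = (\<Sum>x\<in>?I. weight p x)"
    by (intro sum.cong refl prob_prefix_word[OF ind]) (use p in auto)
  also have "\<dots> = subseq_weight p A n w"
    using A by (auto simp: subseq_weight_def finite_words intro!: sum.mono_neutral_cong_left)
  finally show ?thesis .
qed

section \<open>Two independent i.i.d. sequences with a common law on a finite alphabet\<close>

locale iid_pair = prob_space +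
  fixes A :: "'b set" and X Y :: "nat \<Rightarrow> 'a \<Rightarrow> 'b"
  assumes finite_alphabet: "finite A"
    and iid_X: "iid_on_alphabet M A X"
    and iid_Y: "iid_on_alphabet M A Y"
    and same_distr: "distr M (count_space A) (Y 1) = distr M (count_space A) (X 1)"
    and indep_XY: "indep_sequences M A X Y"
begin

abbreviation "p \<equiv> letter_prob M X"

lemma indep_vars_X: "indep_vars (\<lambda>_. count_space A) X {1..}"
  and indep_vars_Y: "indep_vars (\<lambda>_. count_space A) Y {1..}"
  using iid_X iid_Y by (auto simp: iid_on_alphabet_def)

lemma measurable_X: "i \<ge> 1 \<Longrightarrow> X i \<in> M \<rightarrow>\<^sub>M count_space A"
  and measurable_Y: "i \<ge> 1 \<Longrightarrow> Y i \<in> M \<rightarrow>\<^sub>M count_space A"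
  using indep_vars_X indep_vars_Y by (auto simp: indep_vars_def)

lemma prob_eq_distr:
  assumes "Z \<in> M \<rightarrow>\<^sub>M count_space A" "a \<in> A"
  shows "prob {\<omega> \<in> space M. Z \<omega> = a} = measure (distr M (count_space A) Z) {a}"
  using assms by (simp add: measure_distr vimage_def Int_def conj_commute)

lemma prob_X: "prob {\<omega> \<in> space M. X i \<omega> = a} = p a"
  and prob_Y: "prob {\<omega> \<in> space M. Y i \<omega> = a} = p a" if "i \<ge> 1" "a \<in> A"
proof -
  have "distr M (count_space A) (X i) = distr M (count_space A) (X 1)"
      "distr M (count_space A) (Y i) = distr M (count_space A) (X 1)"
    using iid_X iid_Y same_distr that(1) unfolding iid_on_alphabet_def by metis+
  then show "prob {\<omega> \<in> space M. X i \<omega> = a} = p a" "prob {\<omega> \<in> space M. Y i \<omega> = a} = p a"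
    unfolding letter_prob_def using that
    by (simp_all only: prob_eq_distr measurable_X measurable_Y order.refl)
qed

lemma p_nonneg: "p a \<ge> 0"
  by (simp add: letter_prob_def)

lemma sum_p: "(\<Sum>a\<in>A. p a) = 1"
proof -
  have "(\<Sum>a\<in>A. p a) = prob (\<Union>a\<in>A. {\<omega> \<in> space M. X 1 \<omega> = a})"
    unfolding letter_prob_def
  proof (rule finite_measure_finite_Union[symmetric])
    show "(\<lambda>a. {\<omega> \<in> space M. X 1 \<omega> = a}) ` A \<subseteq> events"
      using measurable_sets[OF measurable_X[of 1], of "{_}"]
      by (auto simp: vimage_def Int_def conj_commute)
  qed (auto simp: finite_alphabet disjoint_family_on_def)
  also have "(\<Union>a\<in>A. {\<omega> \<in> space M. X 1 \<omega> = a}) = space M"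
    using measurable_space[OF measurable_X[of 1]] by auto
  finally show ?thesis by (simp add: prob_space)
qed

lemma indep_component: "i \<ge> 1 \<Longrightarrow> indep_var (count_space A) (X i) (count_space A) (Y i)"
  using indep_var_compose[OF indep_XY[unfolded indep_sequences_def]
      measurable_component_singleton[of i] measurable_component_singleton[of i]]
  by (simp add: comp_def)

lemma indep_words: "indep_var
    (count_space (words A n)) (\<lambda>\<omega>. prefix_word (\<lambda>i. X i \<omega>) n)
    (count_space (words A n)) (\<lambda>\<omega>. prefix_word (\<lambda>i. Y i \<omega>) n)"
proof -
  \<comment> \<open>Only indices from 1 on are read, so the restriction in
    \<open>indep_sequences\<close> is invisible to \<open>prefix_word\<close>.\<close>
  have "prefix_word (\<lambda>i\<in>{1..}. Z i) n = prefix_word Z n" for Z :: "nat \<Rightarrow> 'b"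
    by (simp add: prefix_word_def del: upt_Suc)
  then show ?thesis
    using indep_var_compose[OF indep_XY[unfolded indep_sequences_def]
      prefix_word_measurable[OF finite_alphabet, of n] prefix_word_measurable[OF finite_alphabet, of n]]
    by (simp add: comp_def)
qed

lemma measurable_words:
  "(\<lambda>\<omega>. prefix_word (\<lambda>i. X i \<omega>) n) \<in> M \<rightarrow>\<^sub>M count_space (words A n)"
  "(\<lambda>\<omega>. prefix_word (\<lambda>i. Y i \<omega>) n) \<in> M \<rightarrow>\<^sub>M count_space (words A n)"
  using indep_var_rv1[OF indep_words] indep_var_rv2[OF indep_words] .

text \<open>\<open>L\<close> factors through the pair of prefixes, and every function on a finite
  discrete product is measurable.\<close>

lemma measurable_L [measurable]: "L X Y n \<in> borel_measurable M"
proof -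
  let ?W = "count_space (words A n)"
  define g :: "'b list \<times> 'b list \<Rightarrow> real" where
    "g = (\<lambda>(u, v). real (lcs_length (\<lambda>i. u ! (i - 1)) (\<lambda>i. v ! (i - 1)) n))"
  have "?W \<Otimes>\<^sub>M ?W = count_space (words A n \<times> words A n)"
    by (intro pair_measure_countable countable_finite finite_words finite_alphabet)
  then have "g \<in> borel_measurable (?W \<Otimes>\<^sub>M ?W)" by simp
  from measurable_compose[OF measurable_Pair[OF measurable_words] this]
  have "(\<lambda>\<omega>. g (prefix_word (\<lambda>i. X i \<omega>) n, prefix_word (\<lambda>i. Y i \<omega>) n)) \<in> borel_measurable M" .
  also have "(\<lambda>\<omega>. g (prefix_word (\<lambda>i. X i \<omega>) n, prefix_word (\<lambda>i. Y i \<omega>) n)) = L X Y n"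
    by (simp only: g_def L_def fun_eq_iff prod.case lcs_length_prefix_word[symmetric] simp_thms)
  finally show ?thesis .
qed

text \<open>Holds for \<open>n = 0\<close> too, where the quotient is 0 by convention.\<close>

lemma L_bounds: "0 \<le> L X Y n \<omega> / real n" "L X Y n \<omega> / real n \<le> 1"
  using lcs_length_le[of "\<lambda>i. X i \<omega>" "\<lambda>i. Y i \<omega>" n] by (auto simp: L_def divide_le_eq_1)

lemma integrable_L: "integrable M (\<lambda>\<omega>. L X Y n \<omega> / real n)"
  by (intro integrable_const_bound[of _ 1] AE_I2) (use L_bounds in \<open>simp_all add: abs_of_nonneg del: abs_divide\<close>)

section \<open>Matches at equal positions and the lower bound for the expectation\<close>

lemma prob_match:
  assumes "i \<ge> 1"
  shows "prob {\<omega> \<in> space M. X i \<omega> = Y i \<omega>} = p_o M A X"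
    and "{\<omega> \<in> space M. X i \<omega> = Y i \<omega>} \<in> events"
proof -
  let ?E = "\<lambda>a. {\<omega> \<in> space M. X i \<omega> = a \<and> Y i \<omega> = a}"
  have eq: "{\<omega> \<in> space M. X i \<omega> = Y i \<omega>} = (\<Union>a\<in>A. ?E a)"
    using measurable_space[OF measurable_X[OF assms]] by force
  have E: "?E a \<in> events" if "a \<in> A" for a
  proof -
    have "(X i -` {a} \<inter> space M) \<inter> (Y i -` {a} \<inter> space M) \<in> events"
      using that assms
      by (intro sets.Int measurable_sets[OF measurable_X] measurable_sets[OF measurable_Y]) auto
    also have "(X i -` {a} \<inter> space M) \<inter> (Y i -` {a} \<inter> space M) = ?E a" by auto
    finally show ?thesis .
  qed
  then show "{\<omega> \<in> space M. X i \<omega> = Y i \<omega>} \<in> events"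
    unfolding eq using finite_alphabet by (intro sets.finite_UN) auto
  have "prob (?E a) = (p a)\<^sup>2" if "a \<in> A" for a
  proof -
    have "prob (?E a) = \<P>(\<omega> in M. X i \<omega> \<in> {a} \<and> Y i \<omega> \<in> {a})" by simp
    also have "\<dots> = \<P>(\<omega> in M. X i \<omega> \<in> {a}) * \<P>(\<omega> in M. Y i \<omega> \<in> {a})"
      using that by (intro prob_indep_random_variable[OF indep_component[OF assms]]) auto
    finally show ?thesis using that assms by (simp add: prob_X prob_Y power2_eq_square)
  qed
  then show "prob {\<omega> \<in> space M. X i \<omega> = Y i \<omega>} = p_o M A X"
    unfolding eq p_o_def using E
    by (subst finite_measure_finite_Union) (auto simp: finite_alphabet disjoint_family_on_def)
qed

text \<open>By linearity, the expected number of positions with equal letters is \<open>n\<close>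
  times \<open>p_o\<close>, and these positions form a common subsequence.\<close>

lemma p_o_le_expectation_L:
  assumes "n > 0"
  shows "p_o M A X \<le> expectation (\<lambda>\<omega>. L X Y n \<omega> / real n)"
proof -
  let ?E = "\<lambda>i. {\<omega> \<in> space M. X i \<omega> = Y i \<omega>}"
  have int: "integrable M (indicator (?E i) :: _ \<Rightarrow> real)" if "i \<in> {1..n}" for i
    using that prob_match(2)[of i] by (intro integrable_real_indicator) (auto simp: emeasure_eq_measure)
  have "real n * p_o M A X = (\<Sum>i\<in>{1..n}. expectation (indicator (?E i)))"
    using prob_match by simp
  also have "\<dots> = expectation (\<lambda>\<omega>. \<Sum>i\<in>{1..n}. indicator (?E i) \<omega>)"
    using int by (intro Bochner_Integration.integral_sum[symmetric])
  finally have "p_o M A X = expectation (\<lambda>\<omega>. (\<Sum>i\<in>{1..n}. indicator (?E i) \<omega>) / real n)"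
    using assms by (simp add: field_simps)
  also have "\<dots> \<le> expectation (\<lambda>\<omega>. L X Y n \<omega> / real n)"
  proof (intro integral_mono divide_right_mono integrable_L)
    show "integrable M (\<lambda>\<omega>. (\<Sum>i\<in>{1..n}. indicator (?E i) \<omega>) / real n)"
      using int by (intro integrable_divide Bochner_Integration.integrable_sum)
    fix \<omega> assume "\<omega> \<in> space M"
    then have "(\<Sum>i\<in>{1..n}. indicator (?E i) \<omega>) = real (card {i \<in> {1..n}. X i \<omega> = Y i \<omega>})"
      by (simp add: indicator_def sum.If_cases Int_def)
    then show "(\<Sum>i\<in>{1..n}. indicator (?E i) \<omega>) \<le> L X Y n \<omega>"
      using lcs_length_ge_matches[where n = n] by (simp add: L_def)
  qed simp
  finally show ?thesis .
qed

section \<open>The upper tail of \<open>L\<close> and its relation to the expectation\<close>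

lemma letter_prob_ge: "a \<in> A \<Longrightarrow> 1 - p a \<le> q_param M A X"
  unfolding q_param_def using finite_alphabet by (intro diff_mono Min_le) auto

lemma prob_L_ge_le:
  assumes z: "z \<ge> 1" "z > q_param M A X"
  shows "prob {\<omega> \<in> space M. real k \<le> L X Y n \<omega>}
    \<le> (z\<^sup>2) ^ n * (p_o M A X / (z - q_param M A X)\<^sup>2) ^ k"
proof -
  let ?WX = "\<lambda>\<omega>. prefix_word (\<lambda>i. X i \<omega>) n" and ?WY = "\<lambda>\<omega>. prefix_word (\<lambda>i. Y i \<omega>) n"
  \<comment> \<open>Phrased as membership of the two random words in sets of words, so that their
    independence applies directly.\<close>
  let ?E = "\<lambda>w. {\<omega> \<in> space M. ?WX \<omega> \<in> {x \<in> words A n. subseq w x} \<and>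
    ?WY \<omega> \<in> {x \<in> words A n. subseq w x}}"
  have WX: "?WX \<omega> \<in> words A n" and WY: "?WY \<omega> \<in> words A n" if "\<omega> \<in> space M" for \<omega>
    using measurable_space[OF measurable_words(1)[of n] that]
      measurable_space[OF measurable_words(2)[of n] that] by simp_all
  have E: "?E w \<in> events" for w
  proof -
    have "(?WX -` {x \<in> words A n. subseq w x} \<inter> space M) \<inter>
        (?WY -` {x \<in> words A n. subseq w x} \<inter> space M) \<in> events"
      by (intro sets.Int measurable_sets[OF measurable_words(1)]
        measurable_sets[OF measurable_words(2)]) auto
    then show ?thesis by (simp add: vimage_def Int_def conj_ac)
  qed
  have prob_E: "prob (?E w) = (subseq_weight p A n w)\<^sup>2" for w
  proof -
    have "prob (?E w) = \<P>(\<omega> in M. ?WX \<omega> \<in> {x \<in> words A n. subseq w x}) *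
        \<P>(\<omega> in M. ?WY \<omega> \<in> {x \<in> words A n. subseq w x})"
      by (rule prob_indep_random_variable[OF indep_words]) auto
    also have "{\<omega> \<in> space M. ?WX \<omega> \<in> {x \<in> words A n. subseq w x}} =
        {\<omega> \<in> space M. subseq w (?WX \<omega>)}"
      using WX by auto
    also have "{\<omega> \<in> space M. ?WY \<omega> \<in> {x \<in> words A n. subseq w x}} =
        {\<omega> \<in> space M. subseq w (?WY \<omega>)}"
      using WY by auto
    also have "prob {\<omega> \<in> space M. subseq w (?WX \<omega>)} = subseq_weight p A n w"
      by (rule prob_subseq_prefix_word[OF finite_alphabet measurable_words(1) indep_vars_X prob_X])
    also have "prob {\<omega> \<in> space M. subseq w (?WY \<omega>)} = subseq_weight p A n w"
      by (rule prob_subseq_prefix_word[OF finite_alphabet measurable_words(2) indep_vars_Y prob_Y])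
    finally show ?thesis by (simp add: power2_eq_square)
  qed
  have "{\<omega> \<in> space M. real k \<le> L X Y n \<omega>} \<subseteq> (\<Union>w\<in>words A k. ?E w)"
  proof
    fix \<omega> assume \<omega>: "\<omega> \<in> {\<omega> \<in> space M. real k \<le> L X Y n \<omega>}"
    then obtain w where w: "length w = k" "subseq w (?WX \<omega>)" "subseq w (?WY \<omega>)"
      using lcs_length_ge_word[of k "\<lambda>i. X i \<omega>" "\<lambda>i. Y i \<omega>" n] by (auto simp: L_def)
    \<comment> \<open>The letters of the witness occur in the prefix of X, so the witness is among
      the finitely many words of the union bound.\<close>
    have "set w \<subseteq> set (?WX \<omega>)"
      by (auto elim: list_emb_set[OF w(2)])
    also have "\<dots> \<subseteq> A"
      using WX[of \<omega>] \<omega> by (simp add: words_def)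
    finally have "set w \<subseteq> A" .
    with w \<omega> WX WY show "\<omega> \<in> (\<Union>w\<in>words A k. ?E w)"
      by (auto simp: words_def)
  qed
  then have "prob {\<omega> \<in> space M. real k \<le> L X Y n \<omega>} \<le> prob (\<Union>w\<in>words A k. ?E w)"
    using E finite_words[OF finite_alphabet]
    by (intro finite_measure_mono sets.finite_UN) auto
  also have "\<dots> \<le> (\<Sum>w\<in>words A k. prob (?E w))"
    using E finite_words[OF finite_alphabet]
    by (intro finite_measure_subadditive_finite) auto
  also have "\<dots> = (\<Sum>w\<in>words A k. (subseq_weight p A n w)\<^sup>2)"
    by (simp only: prob_E)
  also have "\<dots> \<le> (z\<^sup>2) ^ n * (p_o M A X / (z - q_param M A X)\<^sup>2) ^ k"
    unfolding p_o_def using assms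
    by (intro sum_subseq_weight_power2_le finite_alphabet sum_p p_nonneg letter_prob_ge)
  finally show ?thesis .
qed

text \<open>Dominated convergence with the constant 1, applied to the almost sure limit.\<close>

lemma expectation_L_tendsto:
  assumes "is_chvatal_sankoff_constant M X Y \<gamma>"
  shows "(\<lambda>n. expectation (\<lambda>\<omega>. L X Y n \<omega> / real n)) \<longlonglongrightarrow> \<gamma>"
proof -
  have "(\<lambda>n. expectation (\<lambda>\<omega>. L X Y n \<omega> / real n)) \<longlonglongrightarrow> expectation (\<lambda>_. \<gamma>)"
  proof (rule integral_dominated_convergence[where w = "\<lambda>_. 1"])
    show "AE \<omega> in M. (\<lambda>n. L X Y n \<omega> / real n) \<longlonglongrightarrow> \<gamma>"
      using assms by (simp add: is_chvatal_sankoff_constant_def)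
    show "AE \<omega> in M. norm (L X Y n \<omega> / real n) \<le> 1" for n
      using L_bounds[of n] by (simp add: abs_of_nonneg del: abs_divide)
  qed auto
  then show ?thesis by (simp add: prob_space)
qed

text \<open>A reverse Markov inequality: \<open>L / n\<close> is at most \<open>c\<close> below the
  threshold and at most 1 above it. Expectations near \<gamma> thus force a tail probability bounded
  away from 0.\<close>

lemma expectation_L_le:
  assumes "c \<ge> 0"
  shows "expectation (\<lambda>\<omega>. L X Y n \<omega> / real n)
    \<le> c + prob {\<omega> \<in> space M. real (nat \<lceil>c * real n\<rceil>) \<le> L X Y n \<omega>}"
proof -
  let ?E = "{\<omega> \<in> space M. real (nat \<lceil>c * real n\<rceil>) \<le> L X Y n \<omega>}"
  have "expectation (\<lambda>\<omega>. L X Y n \<omega> / real n) \<le> expectation (\<lambda>\<omega>. c + indicator ?E \<omega>)"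
  proof (intro integral_mono integrable_L)
    show "integrable M (\<lambda>\<omega>. c + indicator ?E \<omega>)"
      by (intro Bochner_Integration.integrable_add integrable_real_indicator)
        (auto simp: emeasure_eq_measure)
    fix \<omega> assume \<omega>: "\<omega> \<in> space M"
    show "L X Y n \<omega> / real n \<le> c + indicator ?E \<omega>"
    proof (cases "\<omega> \<in> ?E")
      case True
      then show ?thesis using L_bounds(2)[of n \<omega>] assms by simp
    next
      case False
      \<comment> \<open>As \<open>L\<close> is an integer, lying below the ceiling means lying below
        \<open>c * real n\<close> itself.\<close>
      then have "L X Y n \<omega> \<le> c * real n"
        using \<omega> by (simp add: L_def)
      then show ?thesis
        using assms False by (cases "n = 0") (auto simp: divide_le_eq)
    qed
  qed
  also have "\<dots> = c + prob ?E"
    by (subst Bochner_Integration.integral_add)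
      (auto simp: prob_space emeasure_eq_measure intro!: integrable_real_indicator)
  finally show ?thesis .
qed

end

section \<open>Combining the tail bound with the limit of the expectations\<close>

theorem theorem3p1:
  fixes M :: "'w measure" and A :: "'a set"
    and X Y :: "nat \<Rightarrow> 'w \<Rightarrow> 'a" and \<gamma> :: real
  assumes "prob_space M"
    and "finite A"
    and "iid_on_alphabet M A X"
    and "iid_on_alphabet M A Y"
    and "distr M (count_space A) (Y 1) = distr M (count_space A) (X 1)"
    and "indep_sequences M A X Y"
    and "is_chvatal_sankoff_constant M X Y \<gamma>"
  shows "\<gamma> * log 2 (p_o M A X) + 2 * (1 - \<gamma>) * log 2 (q_param M A X)
           + 2 * binary_entropy \<gamma> \<ge> 0"
proof -
  interpret iid_pair M A X Y
    using assms(1-6) by (simp add: iid_pair_def iid_pair_axioms_def)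
  let ?q = "q_param M A X" and ?r = "p_o M A X"
  have "A \<noteq> {}" using sum_p by auto
  then have "Min (p ` A) \<in> p ` A" using finite_alphabet by (intro Min_in) auto
  then obtain b where b: "b \<in> A" "p b = 1 - ?q" by (auto simp: q_param_def)
  have q_nonneg: "0 \<le> ?q"
    using b member_le_sum[of b A p] p_nonneg sum_p finite_alphabet by simp
  \<comment> \<open>\<open>p_o\<close> is the average of p(a) with weights p(a), and each p(a) is at
    least 1 - q.\<close>
  have "1 - ?q = (\<Sum>a\<in>A. p a * (1 - ?q))"
    by (simp add: sum_distrib_right[symmetric] sum_p)
  also have "\<dots> \<le> ?r"
    unfolding p_o_def power2_eq_square
    using letter_prob_ge p_nonneg by (intro sum_mono mult_left_mono) force+
  finally have q_le: "1 - ?q \<le> ?r" .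
  have r_pos: "0 < ?r"
  proof -
    obtain a where "a \<in> A" "p a \<noteq> 0" using sum_p by (metis sum.neutral zero_neq_one)
    then show ?thesis
      unfolding p_o_def using finite_alphabet by (intro sum_pos2[of _ a]) auto
  qed
  note lim = expectation_L_tendsto[OF assms(7)]
  \<comment> \<open>This supplies both \<gamma> > 0 and, with \<open>q_le\<close>, the condition 1 -
    q \<le> \<gamma> for the optimal z.\<close>
  have r_le: "?r \<le> \<gamma>"
    by (rule tendsto_lowerbound[OF lim eventually_mono[OF eventually_gt_at_top[of 0]]])
      (use p_o_le_expectation_L in auto)
  have g_le: "\<gamma> \<le> 1"
    using L_bounds(2) integrable_L
    by (intro tendsto_upperbound[OF lim] always_eventually allI integral_le_const) auto
  show ?thesis
  proof (rule entropy_bound_of_exponents)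
    fix z :: real assume z: "z \<ge> 1" "z > ?q"
    let ?c = "?r / (z - ?q)\<^sup>2"
    have c_pos: "?c > 0" using r_pos z by simp
    show "0 \<le> ln (z\<^sup>2) + \<gamma> * ln ?c"
    proof (rule growth_exponent_nonneg)
      fix d assume d: "0 < d" "d < \<gamma>"
      \<comment> \<open>An expectation above \<gamma> - d/2 against the threshold \<gamma> - d
        leaves at least d/2 for the tail probability.\<close>
      have "\<forall>\<^sub>F n in sequentially. \<gamma> - d / 2 < expectation (\<lambda>\<omega>. L X Y n \<omega> / real n)"
        using d by (intro order_tendstoD(1)[OF lim]) simp
      then have "\<forall>\<^sub>F n in sequentially.
          d / 2 \<le> exp (real n * ln (z\<^sup>2) + real (nat \<lceil>(\<gamma> - d) * real n\<rceil>) * ln ?c)"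
      proof eventually_elim
        case (elim n)
        let ?k = "nat \<lceil>(\<gamma> - d) * real n\<rceil>"
        have "d / 2 \<le> prob {\<omega> \<in> space M. real ?k \<le> L X Y n \<omega>}"
          using elim expectation_L_le[of "\<gamma> - d" n] d by simp
        also have "\<dots> \<le> (z\<^sup>2) ^ n * ?c ^ ?k"
          using z by (rule prob_L_ge_le)
        also have "\<dots> = exp (real n * ln (z\<^sup>2) + real ?k * ln ?c)"
          using z(1) c_pos by (simp add: exp_add exp_of_nat_mult)
        finally show ?case .
      qed
      then show "\<exists>e>0. \<forall>\<^sub>F n in sequentially.
          e \<le> exp (real n * ln (z\<^sup>2) + real (nat \<lceil>(\<gamma> - d) * real n\<rceil>) * ln ?c)"
        using d by (intro exI[of _ "d / 2"]) simp
    qed (use r_pos r_le in simp)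
  qed (use r_pos r_le g_le q_nonneg q_le in auto)
qed

end
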